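(* Let $Y\sim Q\in\mathcal P_2(\mathbb R)$ and $N\sim\mathcal N(0,1)$ be independent, and let $p_Z=Q*\phi$ be the density of $Z=Y+N$, where $\phi$ is the standard normal density. Then $$\operatorname{mmse}(Q)=1-\mathcal I(p_Z).$$
   Context: $\mathcal P_2(\mathbb R)$ is the set of Borel probability measures on $\mathbb R$ with finite second moment. $\operatorname{mmse}(Q)=\mathbb E[\operatorname{Var}(Y\mid Y+N)]$ for $Y\sim Q$ and $N\sim\mathcal N(0,1)$ independent. $(Q*\phi)(z)=\int\phi(z-y)\,Q(dy)$. For an a.e. positive differentiable density $\rho$ on $\mathbb R$, its (location) Fisher information is $\mathcal I(\rho)=\int_{\mathbb R}\rho'(z)^2/\rho(z)\,dz$. *)

theory Defs
  imports "HOL-Probability.Probability"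
begin

definition P2 :: "real measure set" where
  "P2 = {Q. prob_space Q \<and> sets Q = sets borel \<and> integrable Q (\<lambda>y. y\<^sup>2)}"

text \<open>Conditional expectation and variance given a real random variable \<open>Z\<close>, that is, given
  the sigma-algebra generated by \<open>Z\<close>. As usual they are determined up to null sets.\<close>

definition cond_exp_rv :: "'a measure \<Rightarrow> ('a \<Rightarrow> real) \<Rightarrow> ('a \<Rightarrow> real) \<Rightarrow> 'a \<Rightarrow> real" where
  "cond_exp_rv M Z X = real_cond_exp M (vimage_algebra (space M) Z borel) X"

definition cond_variance_rv :: "'a measure \<Rightarrow> ('a \<Rightarrow> real) \<Rightarrow> ('a \<Rightarrow> real) \<Rightarrow> 'a \<Rightarrow> real" where
  "cond_variance_rv M Z X = cond_exp_rv M Z (\<lambda>\<omega>. (X \<omega> - cond_exp_rv M Z X \<omega>)\<^sup>2)"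

text \<open>The product space carries the canonical independent pair: \<open>Y = fst\<close> has law \<open>Q\<close> and
  \<open>N = snd\<close> is standard normal. Lemma \<open>mmse_eq\<close> below shows that every other choice of
  such a pair yields the same number.\<close>

definition mmse :: "real measure \<Rightarrow> real" where
  "mmse Q = (let M = Q \<Otimes>\<^sub>M std_normal_distribution
             in \<integral>\<omega>. cond_variance_rv M (\<lambda>\<omega>. fst \<omega> + snd \<omega>) fst \<omega> \<partial>M)"

definition gauss_conv :: "real measure \<Rightarrow> real \<Rightarrow> real" where
  "gauss_conv Q z = (\<integral>y. std_normal_density (z - y) \<partial>Q)"

text \<open>A priori the Fisher information may be infinite, hence the nonnegative integral.
  The value is meaningful for a.e. positive differentiable densities.\<close>

definition fisher_information :: "(real \<Rightarrow> real) \<Rightarrow> ennreal" where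
  "fisher_information \<rho> = (\<integral>\<^sup>+z. ennreal ((deriv \<rho> z)\<^sup>2 / \<rho> z) \<partial>lborel)"

lemma subalgebra_vimage_rv:
  assumes "Z \<in> borel_measurable M"
  shows "subalgebra M (vimage_algebra (space M) Z borel)"
  using assms by (auto simp: subalgebra_def sets_vimage_algebra2 measurable_def)

lemma finite_measure_subalgebra_vimage_rv:
  assumes "prob_space M" "Z \<in> borel_measurable M"
  shows "finite_measure_subalgebra M (vimage_algebra (space M) Z borel)"
  using assms prob_space.finite_measure subalgebra_vimage_rv
  by (auto simp: finite_measure_subalgebra_def finite_measure_subalgebra_axioms_def)

lemma cond_exp_rv_distr:
  fixes Z X :: "'b \<Rightarrow> real"
  assumes M: "prob_space M" and g[measurable]: "g \<in> measurable M M'"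
    and Z[measurable]: "Z \<in> borel_measurable M'"
    and X: "integrable (distr M M' g) X"
  shows "AE \<omega> in M. cond_exp_rv M (\<lambda>\<omega>. Z (g \<omega>)) (\<lambda>\<omega>. X (g \<omega>)) \<omega>
                    = cond_exp_rv (distr M M' g) Z X (g \<omega>)"
proof -
  let ?D = "distr M M' g"
  let ?F = "vimage_algebra (space M) (\<lambda>\<omega>. Z (g \<omega>)) borel"
  let ?G = "vimage_algebra (space ?D) Z borel"
  have D: "prob_space ?D" by (rule prob_space.prob_space_distr[OF M g])
  interpret F: finite_measure_subalgebra M ?F
    by (rule finite_measure_subalgebra_vimage_rv[OF M]) simp
  interpret G: finite_measure_subalgebra ?D ?G
    by (rule finite_measure_subalgebra_vimage_rv[OF D]) simp
  have sp: "g \<in> space M \<rightarrow> space M'" using g by (rule measurable_space[THEN funcsetI])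
  have gF: "g \<in> measurable ?F ?G"
  proof (rule measurableI)
    fix A assume "A \<in> sets ?G"
    then obtain B where B: "B \<in> sets borel" "A = Z -` B \<inter> space M'"
      by (auto simp: sets_vimage_algebra2)
    have "g -` A \<inter> space ?F = (\<lambda>\<omega>. Z (g \<omega>)) -` B \<inter> space M"
      using sp B by auto
    then show "g -` A \<inter> space ?F \<in> sets ?F"
      using B by (auto simp: sets_vimage_algebra2)
  qed (use sp in auto)
  define h where "h = real_cond_exp ?D ?G X"
  have hD: "integrable ?D h" unfolding h_def by (rule G.real_cond_exp_int(1)[OF X])
  have hG: "h \<in> borel_measurable ?G" unfolding h_def by simp
  have "AE \<omega> in M. real_cond_exp M ?F (\<lambda>\<omega>. X (g \<omega>)) \<omega> = h (g \<omega>)"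
  proof (rule F.real_cond_exp_charact)
    show "integrable M (\<lambda>\<omega>. X (g \<omega>))" by (rule integrable_distr[OF g X])
    show "integrable M (\<lambda>\<omega>. h (g \<omega>))" by (rule integrable_distr[OF g hD])
    show "(\<lambda>\<omega>. h (g \<omega>)) \<in> borel_measurable ?F" by (rule measurable_compose[OF gF hG])
    fix A assume "A \<in> sets ?F"
    then obtain B where B: "B \<in> sets borel" "A = (\<lambda>\<omega>. Z (g \<omega>)) -` B \<inter> space M"
      using sp by (auto simp: sets_vimage_algebra2)
    define C where "C = Z -` B \<inter> space M'"
    have C: "C \<in> sets ?G" using B by (auto simp: C_def sets_vimage_algebra2)
    have CM[measurable]: "C \<in> sets M'" using B(1) Z by (auto simp: C_def)
    have ind: "indicator A \<omega> = (indicator C (g \<omega>) :: real)" if "\<omega> \<in> space M" for \<omega>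
      using that sp by (auto simp: B C_def indicator_def)
    have tr: "(\<integral>\<omega>\<in>A. u (g \<omega>) \<partial>M) = (\<integral>x\<in>C. u x \<partial>?D)" if "integrable ?D u" for u :: "'b \<Rightarrow> real"
    proof -
      have u[measurable]: "u \<in> borel_measurable M'" using borel_measurable_integrable[OF that] by simp
      show ?thesis unfolding set_lebesgue_integral_def
        by (subst integral_distr[OF g]) (auto intro!: Bochner_Integration.integral_cong simp: ind)
    qed
    show "(\<integral>\<omega>\<in>A. X (g \<omega>) \<partial>M) = (\<integral>\<omega>\<in>A. h (g \<omega>) \<partial>M)"
      unfolding tr[OF X] tr[OF hD] unfolding h_def by (rule G.real_cond_exp_intA[OF X C])
  qed
  then show ?thesis by (simp add: cond_exp_rv_def h_def)
qed

lemma mmse_eq: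
  assumes Q: "Q \<in> P2" and M: "prob_space M"
    and ind: "prob_space.indep_var M borel Y borel N"
    and Y: "distr M borel Y = Q"
    and N: "distributed M lborel N std_normal_density"
  shows "mmse Q = (\<integral>\<omega>. cond_variance_rv M (\<lambda>\<omega>. Y \<omega> + N \<omega>) Y \<omega> \<partial>M)"
proof -
  interpret prob_space M by (rule M)
  let ?P = "Q \<Otimes>\<^sub>M std_normal_distribution"
  let ?B = "borel \<Otimes>\<^sub>M borel :: (real \<times> real) measure"
  define g where "g = (\<lambda>\<omega>. (Y \<omega>, N \<omega>))"
  have [measurable]: "random_variable borel Y" "random_variable borel N"
    using ind by (auto simp: indep_var_distribution_eq)
  have g[measurable]: "g \<in> measurable M ?B" unfolding g_def by measurable
  have N': "distr M borel N = std_normal_distribution"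
    using N by (simp add: distributed_def cong: distr_cong)
  have D: "distr M ?B g = ?P"
    using ind unfolding indep_var_distribution_eq g_def by (simp add: Y N')
  let ?Z = "\<lambda>x::real\<times>real. fst x + snd x"
  have cv: "cond_variance_rv M (\<lambda>\<omega>. Y \<omega> + N \<omega>) Y
            = cond_variance_rv M (\<lambda>\<omega>. ?Z (g \<omega>)) (\<lambda>\<omega>. fst (g \<omega>))"
    by (simp add: g_def)
  have Zm[measurable]: "?Z \<in> borel_measurable ?B" by measurable
  have PD: "prob_space (distr M ?B g)" by (rule prob_space_distr[OF g])
  have Zm': "?Z \<in> borel_measurable (distr M ?B g)" by simp
  interpret G: finite_measure_subalgebra "distr M ?B g" "vimage_algebra (space (distr M ?B g)) ?Z borel"
    by (rule finite_measure_subalgebra_vimage_rv[OF PD Zm'])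
  interpret F: finite_measure_subalgebra M "vimage_algebra (space M) (\<lambda>\<omega>. ?Z (g \<omega>)) borel"
    by (rule finite_measure_subalgebra_vimage_rv[OF M]) simp
  define E where "E = cond_exp_rv (distr M ?B g) ?Z fst"
  have Em[measurable]: "E \<in> borel_measurable ?B"
    using borel_measurable_cond_exp2[of "distr M ?B g"] unfolding E_def cond_exp_rv_def by simp
  have Y2: "integrable M (\<lambda>\<omega>. (Y \<omega>)\<^sup>2)"
  proof (rule integrable_distr[of Y M borel])
    show "integrable (distr M borel Y) (\<lambda>y. y\<^sup>2)" using Q by (simp add: Y P2_def)
  qed simp
  have Y1: "integrable M Y"
    by (rule square_integrable_imp_integrable[OF _ Y2]) simp
  have fst1: "integrable (distr M ?B g) fst"
    by (subst integrable_distr_eq[OF g]) (auto simp: g_def Y1)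
  have fst2: "integrable (distr M ?B g) (\<lambda>x. (fst x)\<^sup>2)"
    by (subst integrable_distr_eq[OF g]) (auto simp: g_def Y2)
  have E2: "integrable (distr M ?B g) (\<lambda>x. (E x)\<^sup>2)"
    unfolding E_def cond_exp_rv_def
    by (rule G.integrable_convex_cond_exp[where I = UNIV and q = "\<lambda>x. x\<^sup>2"])
       (use fst1 fst2 in \<open>auto simp: convex_power2\<close>)
  have int: "integrable (distr M ?B g) (\<lambda>x. (fst x - E x)\<^sup>2)"
  proof (rule Bochner_Integration.integrable_bound[where f = "\<lambda>x. 2 * (fst x)\<^sup>2 + 2 * (E x)\<^sup>2"])
    have "(a - b)\<^sup>2 \<le> 2 * a\<^sup>2 + 2 * b\<^sup>2" for a b :: real
      using zero_le_power2[of "a + b"] by (simp add: power2_eq_square algebra_simps)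
    then show "AE x in distr M ?B g. norm ((fst x - E x)\<^sup>2) \<le> norm (2 * (fst x)\<^sup>2 + 2 * (E x)\<^sup>2)"
      by (intro AE_I2) (auto simp: order_trans[OF _ abs_ge_self])
  qed (use fst2 E2 in auto)
  have inner: "AE \<omega> in M. cond_exp_rv M (\<lambda>\<omega>. ?Z (g \<omega>)) (\<lambda>\<omega>. fst (g \<omega>)) \<omega> = E (g \<omega>)"
    unfolding E_def by (rule cond_exp_rv_distr[OF M g Zm fst1])
  let ?V = "cond_exp_rv M (\<lambda>\<omega>. ?Z (g \<omega>)) (\<lambda>\<omega>. (fst (g \<omega>) - E (g \<omega>))\<^sup>2)"
  have [measurable]: "cond_exp_rv M (\<lambda>\<omega>. ?Z (g \<omega>)) u \<in> borel_measurable M" for u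
    by (simp add: cond_exp_rv_def)
  have 1: "AE \<omega> in M. cond_variance_rv M (\<lambda>\<omega>. Y \<omega> + N \<omega>) Y \<omega> = ?V \<omega>"
    unfolding cv
    unfolding cond_variance_rv_def
    unfolding cond_exp_rv_def[of M _ "\<lambda>\<omega>. (_ \<omega>)\<^sup>2"]
  proof (rule F.real_cond_exp_cong)
    show "AE \<omega> in M. (fst (g \<omega>) - cond_exp_rv M (\<lambda>\<omega>. ?Z (g \<omega>)) (\<lambda>\<omega>. fst (g \<omega>)) \<omega>)\<^sup>2
                      = (fst (g \<omega>) - E (g \<omega>))\<^sup>2"
      using inner by eventually_elim simp
  qed measurable
  have 2: "AE \<omega> in M. ?V \<omega> = cond_variance_rv (distr M ?B g) ?Z fst (g \<omega>)"
    using cond_exp_rv_distr[OF M g Zm int] unfolding cond_variance_rv_def E_def .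
  have cm: "cond_variance_rv (distr M ?B g) ?Z fst \<in> borel_measurable ?B"
    using borel_measurable_cond_exp2[of "distr M ?B g"]
    unfolding cond_variance_rv_def cond_exp_rv_def by simp
  have "mmse Q = (\<integral>x. cond_variance_rv (distr M ?B g) ?Z fst x \<partial>distr M ?B g)"
    by (simp add: mmse_def D Let_def)
  also have "\<dots> = (\<integral>\<omega>. cond_variance_rv (distr M ?B g) ?Z fst (g \<omega>) \<partial>M)"
    by (rule integral_distr[OF g cm])
  also have "\<dots> = (\<integral>\<omega>. cond_variance_rv M (\<lambda>\<omega>. Y \<omega> + N \<omega>) Y \<omega> \<partial>M)"
  proof (rule integral_cong_AE)
    show "AE \<omega> in M. cond_variance_rv (distr M ?B g) ?Z fst (g \<omega>)
                     = cond_variance_rv M (\<lambda>\<omega>. Y \<omega> + N \<omega>) Y \<omega>"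
      using 1 2 by eventually_elim simp
    show "(\<lambda>\<omega>. cond_variance_rv (distr M ?B g) ?Z fst (g \<omega>)) \<in> borel_measurable M"
      by (rule measurable_compose[OF g cm])
    show "cond_variance_rv M (\<lambda>\<omega>. Y \<omega> + N \<omega>) Y \<in> borel_measurable M"
      by (simp add: cond_variance_rv_def cond_exp_rv_def)
  qed
  finally show ?thesis .
qed

end

theory Submission
  imports Defs
begin

text \<open>
  Under the law of \<open>(Z, Y)\<close>, which has density \<open>\<phi> (z - y)\<close> with respect to
  \<open>dz \<otimes> Q(dy)\<close>, the identity \<open>\<phi>' x = - x \<phi> x\<close> and differentiation under the integral give
  Tweedie's formula \<open>E[N | Z] = h Z\<close> with \<open>h = - p' / p\<close>. As \<open>Y + N = Z\<close>, the errors
  \<open>Y - E[Y | Z]\<close> and \<open>N - E[N | Z]\<close> differ only in sign, so by orthogonality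
  \<open>mmse Q = E[N\<^sup>2] - E[(h Z)\<^sup>2]\<close>, where \<open>E[N\<^sup>2] = 1\<close> and \<open>E[(h Z)\<^sup>2] = \<integral> p'\<^sup>2 / p\<close>.
\<close>

section \<open>Differentiation of the Gaussian convolution\<close>

text \<open>Dominated convergence is applied to the difference quotients. Since it speaks of
  sequences, the limit defining the derivative is first rewritten along sequences avoiding
  \<open>z\<close>. The constant \<open>C\<close> is integrable because the measure is
  finite.\<close>

lemma has_real_derivative_integral_bounded:
  fixes f f' :: "real \<Rightarrow> 'b \<Rightarrow> real"
  assumes M: "finite_measure M"
    and f: "\<And>z. integrable M (f z)"
    and f'[measurable]: "\<And>z. f' z \<in> borel_measurable M"
    and deriv: "\<And>z y. ((\<lambda>z. f z y) has_real_derivative f' z y) (at z)"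
    and bound: "\<And>z y. \<bar>f' z y\<bar> \<le> C"
  shows "((\<lambda>z. \<integral>y. f z y \<partial>M) has_real_derivative (\<integral>y. f' z y \<partial>M)) (at z)"
  unfolding has_field_derivative_iff tendsto_at_iff_sequentially comp_def
proof (intro allI impI)
  interpret finite_measure M by (rule M)
  have [measurable]: "f z \<in> borel_measurable M" for z
    using f by (rule borel_measurable_integrable)
  fix X :: "nat \<Rightarrow> real" assume X: "\<forall>i. X i \<in> UNIV - {z}" and Xz: "X \<longlonglongrightarrow> z"
  have "(\<lambda>i. \<integral>y. (f (X i) y - f z y) / (X i - z) \<partial>M) \<longlonglongrightarrow> (\<integral>y. f' z y \<partial>M)"
  proof (rule integral_dominated_convergence[where w = "\<lambda>_. C"])
    show "AE y in M. (\<lambda>i. (f (X i) y - f z y) / (X i - z)) \<longlonglongrightarrow> f' z y"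
    proof (rule AE_I2)
      fix y
      show "(\<lambda>i. (f (X i) y - f z y) / (X i - z)) \<longlonglongrightarrow> f' z y"
        using deriv[where z = z and y = y] X Xz
        unfolding has_field_derivative_iff tendsto_at_iff_sequentially comp_def by blast
    qed
    show "AE y in M. norm ((f (X i) y - f z y) / (X i - z)) \<le> C" for i
    proof (rule AE_I2)
      fix y
      \<comment> \<open>The mean value inequality turns the bound on the derivative into a Lipschitz
        bound, so every difference quotient is dominated by the same \<open>C\<close>.\<close>
      have "norm (f (X i) y - f z y) \<le> C * norm (X i - z)"
        by (rule field_differentiable_bound[where S = UNIV and f' = "\<lambda>z. f' z y"])
           (use deriv bound in auto)
      then show "norm ((f (X i) y - f z y) / (X i - z)) \<le> C"
        using X by (simp add: divide_le_eq)
    qed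
  qed auto
  then show "(\<lambda>i. ((\<integral>y. f (X i) y \<partial>M) - (\<integral>y. f z y \<partial>M)) / (X i - z)) \<longlonglongrightarrow> (\<integral>y. f' z y \<partial>M)"
    using f by simp
qed

lemma std_normal_density_has_derivative:
  "(std_normal_density has_real_derivative - x * std_normal_density x) (at x)"
  unfolding std_normal_density_def[abs_def]
  by (auto intro!: derivative_eq_intros simp: field_simps)

text \<open>Expanding \<open>(\<bar>x\<bar> - 1)\<^sup>2 \<ge> 0\<close> gives
  \<open>\<bar>x\<bar> \<le> 1 + x\<^sup>2 / 2\<close>, and this is at most
  \<open>exp (x\<^sup>2 / 2)\<close>. The constant is not sharp; the lemma supplies a bound on
  \<phi>' that is uniform in the shift.\<close>

lemma abs_mult_std_normal_density_le: "\<bar>x\<bar> * std_normal_density x \<le> 1"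
proof -
  have "\<bar>x\<bar> \<le> 1 + x\<^sup>2 / 2"
    using zero_le_power2[of "\<bar>x\<bar> - 1"] by (simp add: power2_eq_square algebra_simps)
  also have "\<dots> \<le> exp (x\<^sup>2 / 2)" by (rule exp_ge_add_one_self)
  finally have "\<bar>x\<bar> * exp (- x\<^sup>2 / 2) \<le> 1"
    by (simp add: exp_minus field_simps)
  also have "1 \<le> sqrt (2 * pi)" using pi_ge_two by simp
  finally show ?thesis by (simp add: std_normal_density_def field_simps)
qed

lemma std_normal_density_le_1: "std_normal_density x \<le> 1"
proof -
  have "exp (- x\<^sup>2 / 2) \<le> 1" by simp
  also have "1 \<le> sqrt (2 * pi)" using pi_ge_two by simp
  finally show ?thesis by (simp add: std_normal_density_def field_simps)
qed

lemma integrable_std_normal_density_shift: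
  assumes "finite_measure Q" "sets Q = sets borel"
  shows "integrable Q (\<lambda>y. std_normal_density (z - y))"
  by (rule finite_measure.integrable_const_bound[OF assms(1), where B = 1])
     (use assms(2) in \<open>auto simp: std_normal_density_le_1 cong: measurable_cong_sets\<close>)

lemma gauss_conv_has_derivative:
  assumes Q: "finite_measure Q" "sets Q = sets borel"
  shows "(gauss_conv Q has_real_derivative
           (\<integral>y. - (z - y) * std_normal_density (z - y) \<partial>Q)) (at z)"
  unfolding gauss_conv_def[abs_def]
proof (rule has_real_derivative_integral_bounded[OF Q(1), where C = 1])
  show "integrable Q (\<lambda>y. std_normal_density (z - y))" for z
    by (rule integrable_std_normal_density_shift[OF Q])
  show "(\<lambda>y. - (z - y) * std_normal_density (z - y)) \<in> borel_measurable Q" for z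
    using Q(2) by (auto cong: measurable_cong_sets)
  show "((\<lambda>z. std_normal_density (z - y)) has_real_derivative
          - (z - y) * std_normal_density (z - y)) (at z)" for z y
    using DERIV_shift[of std_normal_density "- (z - y) * std_normal_density (z - y)" z "- y"]
      std_normal_density_has_derivative[of "z - y"] by simp
  show "\<bar>- (z - y) * std_normal_density (z - y)\<bar> \<le> 1" for z y
    using abs_mult_std_normal_density_le[of "z - y"] by (simp add: abs_mult abs_minus_commute)
qed

lemma deriv_gauss_conv:
  assumes "finite_measure Q" "sets Q = sets borel"
  shows "deriv (gauss_conv Q) z = (\<integral>y. - (z - y) * std_normal_density (z - y) \<partial>Q)"
  by (rule DERIV_imp_deriv[OF gauss_conv_has_derivative[OF assms]])

lemma borel_measurable_deriv_gauss_conv: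
  assumes Q: "finite_measure Q" "sets Q = sets borel"
  shows "deriv (gauss_conv Q) \<in> borel_measurable borel"
proof -
  interpret finite_measure Q by (rule Q(1))
  have "(\<lambda>z. \<integral>y. - (z - y) * std_normal_density (z - y) \<partial>Q) \<in> borel_measurable borel"
    by (rule borel_measurable_lebesgue_integral)
       (use Q(2) in \<open>auto cong: measurable_cong_sets sets_pair_measure_cong\<close>)
  then show ?thesis by (simp add: deriv_gauss_conv[OF Q, abs_def])
qed

text \<open>The kernel is strictly positive at every point and the whole space has mass 1, so the
  integral is strictly positive. The score p' / p is therefore a genuine quotient at every
  point.\<close>

lemma gauss_conv_pos:
  assumes "prob_space Q" "sets Q = sets borel"
  shows "gauss_conv Q z > 0"
proof -
  interpret prob_space Q by fact
  have "(\<integral>y. 0 \<partial>Q) < (\<integral>y. std_normal_density (z - y) \<partial>Q)"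
    by (rule integral_less_AE_space)
       (auto simp: emeasure_space_1 normal_density_pos integrable_std_normal_density_shift[OF finite_measure_axioms assms(2)])
  then show ?thesis by (simp add: gauss_conv_def)
qed

section \<open>Joint law of the sum and the signal\<close>

text \<open>Given \<open>Y = y\<close>, the sum is the noise translated by \<open>y\<close> and has
  density \<open>f (z - y)\<close>. With Lebesgue measure as first factor, Fubini yields the
  marginal density of the sum and its conditional expectations by integrating out \<open>y\<close>
  for fixed \<open>z\<close>.\<close>

lemma (in prob_space) distr_sum_pair_eq_density:
  fixes Y N :: "'a \<Rightarrow> real" and f :: "real \<Rightarrow> ennreal"
  assumes ind: "indep_var borel Y borel N" and N: "distributed M lborel N f"
  shows "distr M (lborel \<Otimes>\<^sub>M distr M borel Y) (\<lambda>\<omega>. (Y \<omega> + N \<omega>, Y \<omega>))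
         = density (lborel \<Otimes>\<^sub>M distr M borel Y) (\<lambda>x. f (fst x - snd x))"
    (is "?L = density ?LQ _")
proof (rule measure_eqI)
  let ?Q = "distr M borel Y" and ?D = "density lborel f"
  have [measurable]: "random_variable borel Y" "random_variable borel N"
    using ind by (auto simp: indep_var_distribution_eq)
  have [measurable]: "f \<in> borel_measurable borel"
    using distributed_borel_measurable[OF N] by simp
  have joint: "distr M (borel \<Otimes>\<^sub>M borel) (\<lambda>\<omega>. (Y \<omega>, N \<omega>)) = ?Q \<Otimes>\<^sub>M ?D"
    using ind N unfolding indep_var_distribution_eq distributed_def by (simp cong: distr_cong)
  interpret Q: prob_space ?Q by (rule prob_space_distr) simp
  interpret D: prob_space ?D
    using N unfolding distributed_def by (metis prob_space_distr)
  interpret LQ: pair_sigma_finite lborel ?Q ..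
  fix A assume "A \<in> sets ?L"
  then have A[measurable]: "A \<in> sets (borel \<Otimes>\<^sub>M borel)" by (simp cong: sets_pair_measure_cong)
  have "emeasure ?L A = (\<integral>\<^sup>+\<omega>. indicator A (Y \<omega> + N \<omega>, Y \<omega>) \<partial>M)"
    by (subst nn_integral_indicator[symmetric], use \<open>A \<in> sets ?L\<close> in simp)
       (subst nn_integral_distr, auto cong: measurable_cong_sets sets_pair_measure_cong)
  also have "\<dots> = (\<integral>\<^sup>+x. indicator A (fst x + snd x, fst x)
                     \<partial>distr M (borel \<Otimes>\<^sub>M borel) (\<lambda>\<omega>. (Y \<omega>, N \<omega>)))"
    by (subst nn_integral_distr) auto
  also have "\<dots> = (\<integral>\<^sup>+y. \<integral>\<^sup>+n. indicator A (y + n, y) \<partial>?D \<partial>?Q)"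
    unfolding joint by (subst D.nn_integral_fst[symmetric]) (auto cong: measurable_cong_sets sets_pair_measure_cong)
  also have "\<dots> = (\<integral>\<^sup>+y. \<integral>\<^sup>+z. f (z - y) * indicator A (z, y) \<partial>lborel \<partial>?Q)"
  proof (rule nn_integral_cong)
    fix y
    \<comment> \<open>For fixed \<open>y\<close> this is the substitution \<open>z = y + n\<close>,
      an affine map of slope 1, which preserves Lebesgue measure.\<close>
    show "(\<integral>\<^sup>+n. indicator A (y + n, y) \<partial>?D) = (\<integral>\<^sup>+z. f (z - y) * indicator A (z, y) \<partial>lborel)"
      using nn_integral_real_affine[of "\<lambda>z. f (z - y) * indicator A (z, y)" 1 y]
      by (subst nn_integral_density) auto
  qed
  also have "\<dots> = (\<integral>\<^sup>+x. f (fst x - snd x) * indicator A x \<partial>?LQ)"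
    by (subst LQ.nn_integral_snd[symmetric]) (auto cong: measurable_cong_sets sets_pair_measure_cong)
  also have "\<dots> = emeasure (density ?LQ (\<lambda>x. f (fst x - snd x))) A"
    by (subst emeasure_density) (use \<open>A \<in> sets ?L\<close> in \<open>auto cong: measurable_cong_sets sets_pair_measure_cong\<close>)
  finally show "emeasure ?L A = \<dots>" .
qed (simp)

lemma (in prob_space) distributed_sum_gauss_conv:
  fixes Y N :: "'a \<Rightarrow> real"
  assumes ind: "indep_var borel Y borel N" and N: "distributed M lborel N std_normal_density"
  shows "distributed M lborel (\<lambda>\<omega>. Y \<omega> + N \<omega>) (gauss_conv (distr M borel Y))"
proof -
  let ?Q = "distr M borel Y" and ?Z = "\<lambda>\<omega>. Y \<omega> + N \<omega>"
  have [measurable]: "random_variable borel Y" "random_variable borel N"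
    using ind by (auto simp: indep_var_distribution_eq)
  interpret Q: prob_space ?Q by (rule prob_space_distr) simp
  interpret LQ: pair_sigma_finite lborel ?Q ..
  \<comment> \<open>Differentiability gives continuity, which serves here to obtain measurability of
    the density.\<close>
  have "continuous_on UNIV (gauss_conv ?Q)"
    by (rule DERIV_continuous_on[OF has_field_derivative_at_within[OF gauss_conv_has_derivative]])
       (auto intro: Q.finite_measure_axioms)
  then have [measurable]: "gauss_conv ?Q \<in> borel_measurable borel"
    by (rule borel_measurable_continuous_onI)
  have p: "(\<integral>\<^sup>+y. ennreal (std_normal_density (z - y)) \<partial>?Q) = ennreal (gauss_conv ?Q z)" for z
    unfolding gauss_conv_def
    by (rule nn_integral_eq_integral[OF integrable_std_normal_density_shift])
       (auto intro: Q.finite_measure_axioms)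
  have "distr M lborel ?Z = density lborel (\<lambda>z. ennreal (gauss_conv ?Q z))"
  proof (rule measure_eqI)
    fix A assume "A \<in> sets (distr M lborel ?Z)"
    then have [measurable]: "A \<in> sets borel" by simp
    have "emeasure (distr M lborel ?Z) A = (\<integral>\<^sup>+\<omega>. indicator A (?Z \<omega>) \<partial>M)"
      by (subst nn_integral_indicator[symmetric], simp) (subst nn_integral_distr, auto)
    also have "\<dots> = (\<integral>\<^sup>+x. indicator A (fst x) \<partial>distr M (lborel \<Otimes>\<^sub>M ?Q) (\<lambda>\<omega>. (?Z \<omega>, Y \<omega>)))"
      by (subst nn_integral_distr) (auto cong: measurable_cong_sets sets_pair_measure_cong)
    also have "\<dots> = (\<integral>\<^sup>+x. ennreal (std_normal_density (fst x - snd x)) * indicator A (fst x)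
                       \<partial>(lborel \<Otimes>\<^sub>M ?Q))"
      unfolding distr_sum_pair_eq_density[OF ind N]
      by (subst nn_integral_density) (auto cong: measurable_cong_sets sets_pair_measure_cong)
    \<comment> \<open>The event constrains \<open>z\<close> alone, so after Fubini the indicator
      leaves the inner integral and what remains there is the convolution.\<close>
    also have "\<dots> = (\<integral>\<^sup>+z. \<integral>\<^sup>+y. ennreal (std_normal_density (z - y)) * indicator A z \<partial>?Q \<partial>lborel)"
      by (subst Q.nn_integral_fst[symmetric]) (auto cong: measurable_cong_sets sets_pair_measure_cong)
    also have "\<dots> = (\<integral>\<^sup>+z. ennreal (gauss_conv ?Q z) * indicator A z \<partial>lborel)"
      by (subst nn_integral_multc) (auto simp: p cong: measurable_cong_sets)
    also have "\<dots> = emeasure (density lborel (\<lambda>z. ennreal (gauss_conv ?Q z))) A"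
      by (subst emeasure_density) auto
    finally show "emeasure (distr M lborel ?Z) A = \<dots>" .
  qed simp
  then show ?thesis by (simp add: distributed_def)
qed

section \<open>Tweedie's formula\<close>

text \<open>The candidate is tested on the events that \<open>Y + N\<close> lies in
  \<open>B\<close>, which make up the generated sigma-algebra. There both sides reduce to the
  integral of (z - y) \<phi>(z - y) over \<open>z\<close> in \<open>B\<close> and \<open>y\<close>
  under the law of \<open>Y\<close>. Conditioning the noise rather than the signal makes the
  numerator exactly -p'.\<close>

lemma (in prob_space) cond_exp_gaussian_noise:
  fixes Y N :: "'a \<Rightarrow> real"
  defines "p \<equiv> gauss_conv (distr M borel Y)"
  assumes ind: "indep_var borel Y borel N" and N: "distributed M lborel N std_normal_density"
  shows "AE \<omega> in M. cond_exp_rv M (\<lambda>\<omega>. Y \<omega> + N \<omega>) N \<omega> = - deriv p (Y \<omega> + N \<omega>) / p (Y \<omega> + N \<omega>)"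
proof -
  let ?Q = "distr M borel Y" and ?Z = "\<lambda>\<omega>. Y \<omega> + N \<omega>"
  let ?LQ = "lborel \<Otimes>\<^sub>M ?Q" and ?g = "\<lambda>\<omega>. (?Z \<omega>, Y \<omega>)"
  let ?\<phi> = "std_normal_density"
  define h where "h = (\<lambda>z. - deriv p z / p z)"
  have [measurable]: "random_variable borel Y" "random_variable borel N"
    using ind by (auto simp: indep_var_distribution_eq)
  interpret Q: prob_space ?Q by (rule prob_space_distr) simp
  interpret LQ: pair_sigma_finite lborel ?Q ..
  interpret F: finite_measure_subalgebra M "vimage_algebra (space M) ?Z borel"
    by (rule finite_measure_subalgebra_vimage_rv[OF prob_space_axioms]) simp
  have Z: "distributed M lborel ?Z p"
    unfolding p_def by (rule distributed_sum_gauss_conv[OF ind N])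
  have pos: "p z > 0" for z
    unfolding p_def by (rule gauss_conv_pos[OF Q.prob_space_axioms]) simp
  have dp: "deriv p z = (\<integral>y. - (z - y) * ?\<phi> (z - y) \<partial>?Q)" for z
    unfolding p_def by (rule deriv_gauss_conv) (auto intro: Q.finite_measure_axioms)
  have [measurable]: "deriv p \<in> borel_measurable borel"
    unfolding p_def by (rule borel_measurable_deriv_gauss_conv) (auto intro: Q.finite_measure_axioms)
  have [measurable]: "p \<in> borel_measurable borel"
    using distributed_real_measurable[OF _ Z] pos by (simp add: less_imp_le)
  have [measurable]: "h \<in> borel_measurable borel" unfolding h_def by simp
  \<comment> \<open>The minus sign in \<open>h\<close> cancels the one in \<phi>'(x) = -x \<phi>(x).
    The product with \<open>p\<close> is the form that arises when \<open>h\<close> is integrated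
    against the density of the sum.\<close>
  have ph: "p z * h z = (\<integral>y. ?\<phi> (z - y) * (z - y) \<partial>?Q)" for z
    using pos[of z] unfolding h_def dp by (simp add: algebra_simps flip: integral_minus)
  have int_tr: "integrable M (\<lambda>\<omega>. u (?g \<omega>)) \<longleftrightarrow> integrable ?LQ (\<lambda>x. ?\<phi> (fst x - snd x) * u x)"
    and lint_tr: "(\<integral>\<omega>. u (?g \<omega>) \<partial>M) = (\<integral>x. ?\<phi> (fst x - snd x) * u x \<partial>?LQ)"
    if "u \<in> borel_measurable (borel \<Otimes>\<^sub>M borel)" for u :: "real \<times> real \<Rightarrow> real"
  proof -
    have [measurable]: "u \<in> borel_measurable ?LQ" "?g \<in> measurable M ?LQ"
       "(\<lambda>x. ?\<phi> (fst x - snd x)) \<in> borel_measurable ?LQ"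
      using that by (auto cong: measurable_cong_sets sets_pair_measure_cong)
    have "integrable M (\<lambda>\<omega>. u (?g \<omega>)) \<longleftrightarrow> integrable (distr M ?LQ ?g) u"
      by (rule integrable_distr_eq[symmetric]) auto
    then show "integrable M (\<lambda>\<omega>. u (?g \<omega>)) \<longleftrightarrow> integrable ?LQ (\<lambda>x. ?\<phi> (fst x - snd x) * u x)"
      unfolding distr_sum_pair_eq_density[OF ind N] by (subst (asm) integrable_density) auto
    have "(\<integral>\<omega>. u (?g \<omega>) \<partial>M) = integral\<^sup>L (distr M ?LQ ?g) u"
      by (rule integral_distr[symmetric]) auto
    then show "(\<integral>\<omega>. u (?g \<omega>) \<partial>M) = (\<integral>x. ?\<phi> (fst x - snd x) * u x \<partial>?LQ)"
      unfolding distr_sum_pair_eq_density[OF ind N] by (subst (asm) integral_density) auto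
  qed
  have Nint: "integrable M N"
    using distributed_integrable[OF N, of "\<lambda>x. x"] integrable_std_normal_moment[of 1] by simp
  \<comment> \<open>In the coordinates (z, y) the noise is z - y, so this is the integrability of
    \<open>N\<close>.\<close>
  have int: "integrable ?LQ (\<lambda>x. ?\<phi> (fst x - snd x) * (fst x - snd x))"
    by (subst int_tr[symmetric]) (auto simp: Nint)
  \<comment> \<open>By Fubini the inner integral, which is \<open>p z * h z\<close> by
    \<open>ph\<close>, is integrable in \<open>z\<close>; as \<open>p\<close> is the density of the
    sum, this is integrability of \<open>h\<close> at the sum.\<close>
  have hint: "integrable M (\<lambda>\<omega>. h (?Z \<omega>))"
    using distributed_integrable[OF Z, of h] LQ.integrable_fst'[OF int] pos
    by (simp add: less_imp_le ph)
  have "AE \<omega> in M. real_cond_exp M (vimage_algebra (space M) ?Z borel) N \<omega> = h (?Z \<omega>)"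
  proof (rule F.real_cond_exp_charact[OF _ Nint hint])
    show "(\<lambda>\<omega>. h (?Z \<omega>)) \<in> borel_measurable (vimage_algebra (space M) ?Z borel)"
      by (rule measurable_compose[OF measurable_vimage_algebra1]) auto
    fix A assume "A \<in> sets (vimage_algebra (space M) ?Z borel)"
    then obtain B where B[measurable]: "B \<in> sets borel" and A: "A = ?Z -` B \<inter> space M"
      by (auto simp: sets_vimage_algebra2)
    have intB: "integrable ?LQ (\<lambda>x. ?\<phi> (fst x - snd x) * (indicator B (fst x) * (fst x - snd x)))"
      by (rule Bochner_Integration.integrable_bound[OF int])
         (auto simp: indicator_def cong: measurable_cong_sets sets_pair_measure_cong)
    have "(\<integral>\<omega>\<in>A. N \<omega> \<partial>M) = (\<integral>\<omega>. indicator B (?Z \<omega>) * (?Z \<omega> - Y \<omega>) \<partial>M)"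
      unfolding set_lebesgue_integral_def
      by (rule Bochner_Integration.integral_cong) (auto simp: A indicator_def)
    also have "\<dots> = (\<integral>x. ?\<phi> (fst x - snd x) * (indicator B (fst x) * (fst x - snd x)) \<partial>?LQ)"
      using lint_tr[of "\<lambda>x. indicator B (fst x) * (fst x - snd x)"] by simp
    also have "\<dots> = (\<integral>z. \<integral>y. ?\<phi> (z - y) * (indicator B z * (z - y)) \<partial>?Q \<partial>lborel)"
      using LQ.integral_fst'[OF intB] by simp
    also have "\<dots> = (\<integral>z. p z * (indicator B z * h z) \<partial>lborel)"
      by (rule Bochner_Integration.integral_cong) (auto simp: ph indicator_def)
    also have "\<dots> = (\<integral>\<omega>. indicator B (?Z \<omega>) * h (?Z \<omega>) \<partial>M)"
      by (rule distributed_integral[OF Z]) (use pos in \<open>auto simp: less_imp_le\<close>)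
    also have "\<dots> = (\<integral>\<omega>\<in>A. h (?Z \<omega>) \<partial>M)"
      unfolding set_lebesgue_integral_def
      by (rule Bochner_Integration.integral_cong) (auto simp: A indicator_def)
    finally show "(\<integral>\<omega>\<in>A. N \<omega> \<partial>M) = (\<integral>\<omega>\<in>A. h (?Z \<omega>) \<partial>M)" .
  qed
  then show ?thesis
    by (simp add: cond_exp_rv_def h_def)
qed

section \<open>Mean squared error and Fisher information\<close>

text \<open>The equation lives in the extended reals: with a real left side it also asserts that the
  Fisher information is finite.\<close>

theorem proposition3p7:
  fixes M :: "'a measure" and Y N :: "'a \<Rightarrow> real" and Q :: "real measure"
  assumes "prob_space M"
    and "Q \<in> P2"
    and "prob_space.indep_var M borel Y borel N"
    and "distr M borel Y = Q"
    and "distributed M lborel N std_normal_density"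
  shows "distributed M lborel (\<lambda>\<omega>. Y \<omega> + N \<omega>) (gauss_conv Q) \<and>
         ereal (mmse Q) = 1 - enn2ereal (fisher_information (gauss_conv Q))"
proof -
  interpret prob_space M by fact
  note ind = assms(3) and Q = assms(4) and N = assms(5)
  let ?Z = "\<lambda>\<omega>. Y \<omega> + N \<omega>" and ?p = "gauss_conv Q"
  let ?F = "vimage_algebra (space M) ?Z borel"
  define h where "h = (\<lambda>z. - deriv ?p z / ?p z)"
  have [measurable]: "random_variable borel Y" "random_variable borel N"
    using ind by (auto simp: indep_var_distribution_eq)
  interpret F: finite_measure_subalgebra M ?F
    by (rule finite_measure_subalgebra_vimage_rv[OF prob_space_axioms]) simp
  have Z: "distributed M lborel ?Z ?p"
    using distributed_sum_gauss_conv[OF ind N] by (simp add: Q)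
  have pos: "?p z > 0" for z
    using assms(2) by (intro gauss_conv_pos) (auto simp: P2_def)
  have [measurable]: "deriv ?p \<in> borel_measurable borel"
    using assms(2)
    by (intro borel_measurable_deriv_gauss_conv) (auto simp: P2_def prob_space.finite_measure)
  have [measurable]: "?p \<in> borel_measurable borel"
    using distributed_real_measurable[OF _ Z] pos by (simp add: less_imp_le)
  have hm[measurable]: "h \<in> borel_measurable borel" unfolding h_def by simp
  have EN: "AE \<omega> in M. real_cond_exp M ?F N \<omega> = h (?Z \<omega>)"
    using cond_exp_gaussian_noise[OF ind N] by (simp add: Q cond_exp_rv_def h_def)
  have Y2: "integrable M (\<lambda>\<omega>. (Y \<omega>)\<^sup>2)"
  proof (rule integrable_distr[of Y M borel])
    show "integrable (distr M borel Y) (\<lambda>y. y\<^sup>2)" using assms(2) by (simp add: Q P2_def)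
  qed simp
  have Y1: "integrable M Y"
    by (rule square_integrable_imp_integrable[OF _ Y2]) simp
  have N1: "integrable M N"
    using distributed_integrable[OF N, of "\<lambda>x. x"] integrable_std_normal_moment[of 1] by simp
  have N2: "integrable M (\<lambda>\<omega>. (N \<omega>)\<^sup>2)"
    using distributed_integrable[OF N, of "\<lambda>x. x\<^sup>2"] integrable_std_normal_moment[of 2] by simp
  have EN2: "(\<integral>\<omega>. (N \<omega>)\<^sup>2 \<partial>M) = 1"
    using distributed_integral[OF N, of "\<lambda>x. x\<^sup>2"] integral_std_normal_moment_even[of 1] by simp
  have Zm[measurable]: "?Z \<in> borel_measurable ?F"
    by (rule measurable_vimage_algebra1) auto
  have hF: "(\<lambda>\<omega>. h (?Z \<omega>)) \<in> borel_measurable ?F"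
    by (rule measurable_compose[OF Zm hm])
  \<comment> \<open>Conditional Jensen for the square carries square integrability from
    \<open>N\<close> to its conditional expectation. Finiteness of the Fisher information comes from
    here.\<close>
  have h2: "integrable M (\<lambda>\<omega>. (h (?Z \<omega>))\<^sup>2)"
  proof (rule integrable_cong_AE_imp)
    show "integrable M (\<lambda>\<omega>. (real_cond_exp M ?F N \<omega>)\<^sup>2)"
      by (rule F.integrable_convex_cond_exp[where I = UNIV and q = "\<lambda>x. x\<^sup>2"])
         (use N1 N2 in \<open>auto simp: convex_power2\<close>)
    show "AE \<omega> in M. (real_cond_exp M ?F N \<omega>)\<^sup>2 = (h (?Z \<omega>))\<^sup>2"
      using EN by eventually_elim simp
  qed simp
  have hN: "integrable M (\<lambda>\<omega>. h (?Z \<omega>) * N \<omega>)"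
  proof (rule Bochner_Integration.integrable_bound)
    show "integrable M (\<lambda>\<omega>. (h (?Z \<omega>))\<^sup>2 + (N \<omega>)\<^sup>2)" using h2 N2 by simp
    have "\<bar>a * b\<bar> \<le> a\<^sup>2 + b\<^sup>2" for a b :: real
      using zero_le_power2[of "a + b"] zero_le_power2[of "a - b"]
      by (simp add: power2_eq_square algebra_simps abs_le_iff)
    then show "AE \<omega> in M. norm (h (?Z \<omega>) * N \<omega>) \<le> norm ((h (?Z \<omega>))\<^sup>2 + (N \<omega>)\<^sup>2)"
      by (intro AE_I2) (simp add: order_trans[OF _ abs_ge_self])
  qed simp
  \<comment> \<open>Orthogonality: the factor \<open>h (?Z \<omega>)\<close> is measurable in the
    conditioning variable, so \<open>N\<close> may be replaced by its conditional expectation under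
    the integral.\<close>
  have EhN: "(\<integral>\<omega>. h (?Z \<omega>) * N \<omega> \<partial>M) = (\<integral>\<omega>. (h (?Z \<omega>))\<^sup>2 \<partial>M)"
  proof -
    have "(\<integral>\<omega>. h (?Z \<omega>) * N \<omega> \<partial>M) = (\<integral>\<omega>. h (?Z \<omega>) * real_cond_exp M ?F N \<omega> \<partial>M)"
      by (rule F.real_cond_exp_intg(2)[OF hN hF, symmetric]) simp
    also have "\<dots> = (\<integral>\<omega>. (h (?Z \<omega>))\<^sup>2 \<partial>M)"
    proof (rule integral_cong_AE)
      show "AE \<omega> in M. h (?Z \<omega>) * real_cond_exp M ?F N \<omega> = (h (?Z \<omega>))\<^sup>2"
        using EN by eventually_elim (simp add: power2_eq_square)
    qed auto
    finally show ?thesis .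
  qed
  \<comment> \<open>Write \<open>Y\<close> as \<open>?Z\<close> minus \<open>N\<close>; conditioning
    leaves \<open>?Z\<close> unchanged.\<close>
  have EY: "AE \<omega> in M. real_cond_exp M ?F Y \<omega> = ?Z \<omega> - h (?Z \<omega>)"
  proof -
    have "AE \<omega> in M. real_cond_exp M ?F (\<lambda>\<omega>. ?Z \<omega> - N \<omega>) \<omega>
            = real_cond_exp M ?F ?Z \<omega> - real_cond_exp M ?F N \<omega>"
      using Y1 N1 by (intro F.real_cond_exp_diff) auto
    moreover have "AE \<omega> in M. real_cond_exp M ?F ?Z \<omega> = ?Z \<omega>"
      using Y1 N1 by (intro F.real_cond_exp_F_meas) auto
    ultimately show ?thesis using EN by eventually_elim simp
  qed
  \<comment> \<open>By \<open>EY\<close> the error of \<open>Y\<close> is h(Z) - N. Its square is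
    kept expanded so that each term can be integrated separately.\<close>
  have sq: "AE \<omega> in M. (h (?Z \<omega>))\<^sup>2 - 2 * (h (?Z \<omega>) * N \<omega>) + (N \<omega>)\<^sup>2
              = (Y \<omega> - real_cond_exp M ?F Y \<omega>)\<^sup>2"
    using EY by eventually_elim (simp only:, simp add: power2_eq_square algebra_simps)
  have sqint: "integrable M (\<lambda>\<omega>. (Y \<omega> - real_cond_exp M ?F Y \<omega>)\<^sup>2)"
  proof (rule integrable_cong_AE_imp)
    show "integrable M (\<lambda>\<omega>. (h (?Z \<omega>))\<^sup>2 - 2 * (h (?Z \<omega>) * N \<omega>) + (N \<omega>)\<^sup>2)"
      using h2 hN N2 by simp
  qed (use sq in simp_all)
  \<comment> \<open>Passage from the canonical pair on the product space to the given pair.\<close>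
  have "mmse Q = (\<integral>\<omega>. cond_variance_rv M ?Z Y \<omega> \<partial>M)"
    by (rule mmse_eq[OF assms(2,1) ind Q N])
  also have "\<dots> = (\<integral>\<omega>. (Y \<omega> - real_cond_exp M ?F Y \<omega>)\<^sup>2 \<partial>M)"
    unfolding cond_variance_rv_def cond_exp_rv_def by (rule F.real_cond_exp_int(2)[OF sqint])
  also have "\<dots> = (\<integral>\<omega>. (h (?Z \<omega>))\<^sup>2 - 2 * (h (?Z \<omega>) * N \<omega>) + (N \<omega>)\<^sup>2 \<partial>M)"
    by (rule integral_cong_AE) (use sq in \<open>auto elim: eventually_mono\<close>)
  \<comment> \<open>By \<open>EhN\<close> the cross term contributes -2 E[h(Z)^2], which combines
    with +E[h(Z)^2] and E[N^2] = 1.\<close>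
  also have "\<dots> = 1 - (\<integral>\<omega>. (h (?Z \<omega>))\<^sup>2 \<partial>M)"
    using h2 hN N2 by (simp add: EhN EN2)
  finally have mmse: "mmse Q = 1 - (\<integral>\<omega>. (h (?Z \<omega>))\<^sup>2 \<partial>M)" .
  have "fisher_information ?p = (\<integral>\<^sup>+z. ennreal (?p z) * ennreal ((h z)\<^sup>2) \<partial>lborel)"
    unfolding fisher_information_def
  proof (rule nn_integral_cong)
    fix z
    \<comment> \<open>Positivity of the density permits writing p'^2 / p as p h^2, so the Fisher
      integral becomes the expectation of h(Z)^2.\<close>
    have "(deriv ?p z)\<^sup>2 / ?p z = ?p z * (h z)\<^sup>2"
      using pos[of z] by (simp add: h_def power2_eq_square)
    then show "ennreal ((deriv ?p z)\<^sup>2 / ?p z) = ennreal (?p z) * ennreal ((h z)\<^sup>2)"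
      using pos[of z] by (simp add: ennreal_mult)
  qed
  also have "\<dots> = (\<integral>\<^sup>+\<omega>. ennreal ((h (?Z \<omega>))\<^sup>2) \<partial>M)"
    by (rule distributed_nn_integral[OF Z]) simp
  also have "\<dots> = ennreal (\<integral>\<omega>. (h (?Z \<omega>))\<^sup>2 \<partial>M)"
    by (rule nn_integral_eq_integral[OF h2]) simp
  finally have "enn2ereal (fisher_information ?p) = ereal (\<integral>\<omega>. (h (?Z \<omega>))\<^sup>2 \<partial>M)"
    by (simp add: enn2ereal_ennreal)
  then show ?thesis
    using Z by (simp add: mmse one_ereal_def)
qed

end
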